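(* Let $n = p_1^{r_1}\cdots p_t^{r_t}$ be the prime factorization of $n$, where $t > 1$, $r_i\geq 1$, and $3 \leq p_1 < \dots < p_t$ are primes. Then the packing chromatic number of the unitary Cayley graph $G_{\mathbb{Z}_n}$ is \[ \chi_\rho(G_{\mathbb{Z}_n}) = p_1^{r_1-1} p_2^{r_2}\cdots p_t^{r_t}(p_1-1) + 1. \]
   Context: The unitary Cayley graph $G_{\mathbb{Z}_n}$ of the ring $\mathbb{Z}_n$ has vertex set $\mathbb{Z}_n$, with $x$ and $y$ adjacent if and only if $x-y$ is a unit of $\mathbb{Z}_n$ (i.e. $\gcd(x-y,n)=1$). A packing $k$-coloring of a graph $G$ is a partition of $V(G)$ into $k$ nonempty classes $V_1,\dots,V_k$ such that for each $i\in[k]$, any two distinct vertices $u,v\in V_i$ satisfy $d_G(u,v)\geq i+1$ (where $d_G$ is the shortest-path distance). The packing chromatic number $\chi_\rho(G)$ is the smallest $k$ for which $G$ admits a packing $k$-coloring. *)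

theory Defs
  imports
    "HOL-Number_Theory.Residues"
    "HOL-Library.Disjoint_Sets"
    "Graph_Theory.Graph_Theory"
begin

text \<open>
  An undirected simple graph is represented, as in the locale \<^locale>\<open>pair_graph\<close>, by a
  symmetric loop-free digraph: each edge appears as a pair of opposite arcs.
\<close>

definition unitary_cayley_graph :: "('a, 'b) ring_scheme \<Rightarrow> 'a pair_pre_digraph" where
  "unitary_cayley_graph R =
     \<lparr> pverts = carrier R,
       parcs = {(x, y). x \<in> carrier R \<and> y \<in> carrier R \<and> x \<ominus>\<^bsub>R\<^esub> y \<in> Units R} \<rparr>"

text \<open>
  With unit weights the cost of a walk is its number of arcs; the distance is \<open>\<infinity>\<close> between
  vertices not joined by a walk.
\<close>

definition graph_dist :: "'a pair_pre_digraph \<Rightarrow> 'a \<Rightarrow> 'a \<Rightarrow> ereal" where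
  "graph_dist G u v = wf_digraph.\<mu> (with_proj G) (\<lambda>_. 1) u v"

text \<open>Only the values of \<open>V\<close> on \<open>{1..k}\<close> matter.\<close>

definition packing_coloring :: "'a pair_pre_digraph \<Rightarrow> nat \<Rightarrow> (nat \<Rightarrow> 'a set) \<Rightarrow> bool" where
  "packing_coloring G k V \<longleftrightarrow>
     (\<Union>i\<in>{1..k}. V i) = pverts G \<and>
     disjoint_family_on V {1..k} \<and>
     (\<forall>i\<in>{1..k}. V i \<noteq> {}) \<and>
     (\<forall>i\<in>{1..k}. \<forall>u\<in>V i. \<forall>v\<in>V i. u \<noteq> v \<longrightarrow> ereal (real (i + 1)) \<le> graph_dist G u v)"

definition packing_chromatic_number :: "'a pair_pre_digraph \<Rightarrow> nat" where
  "packing_chromatic_number G = (LEAST k. \<exists>V. packing_coloring G k V)"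

lemma packing_coloring_exists:
  assumes "finite (pverts G)"
  shows "\<exists>k V. packing_coloring G k V"
proof -
  obtain f where f: "bij_betw f {1..card (pverts G)} (pverts G)"
    using ex_bij_betw_nat_finite_1[OF assms] by blast
  have "packing_coloring G (card (pverts G)) (\<lambda>i. {f i})"
    using f unfolding packing_coloring_def disjoint_family_on_def bij_betw_def inj_on_def
    by blast
  then show ?thesis by blast
qed

lemma unitary_cayley_graph_residue_ring_arc_iff:
  fixes n x y :: int
  assumes "1 < n" "x \<in> {0..<n}" "y \<in> {0..<n}"
  shows "(x, y) \<in> parcs (unitary_cayley_graph (residue_ring n)) \<longleftrightarrow> gcd (x - y) n = 1"
proof -
  interpret residues n "residue_ring n"
    by unfold_locales (use assms in auto)
  have "x \<ominus>\<^bsub>residue_ring n\<^esub> y = (x - y) mod n"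
    by (simp add: a_minus_def res_add_eq res_neg_eq mod_simps)
  moreover have "(x - y) mod n \<in> Units (residue_ring n) \<longleftrightarrow> coprime (x - y) n"
    using assms(1) pos_mod_bound[of n "x - y"] pos_mod_sign[of n "x - y"]
    by (cases "(x - y) mod n = 0")
      (auto simp: res_units_eq order_less_le coprime_iff_gcd_eq_1 gcd.commute[of _ n]
        simp flip: gcd_red_int[of n "x - y"])
  ultimately show ?thesis
    using assms by (auto simp: unitary_cayley_graph_def res_carrier_eq coprime_iff_gcd_eq_1)
qed

lemma pair_graph_unitary_cayley_graph:
  fixes n :: int
  assumes "1 < n"
  shows "pair_graph (unitary_cayley_graph (residue_ring n))"
proof -
  let ?G = "unitary_cayley_graph (residue_ring n)"
  interpret residues n "residue_ring n"
    by unfold_locales (use assms in auto)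
  have V: "pverts ?G = {0..<n}"
    by (auto simp: unitary_cayley_graph_def res_carrier_eq)
  have sub: "parcs ?G \<subseteq> pverts ?G \<times> pverts ?G"
    by (auto simp: unitary_cayley_graph_def)
  have arc: "(x, y) \<in> parcs ?G \<longleftrightarrow> x \<in> {0..<n} \<and> y \<in> {0..<n} \<and> gcd (x - y) n = 1" for x y
    using unitary_cayley_graph_residue_ring_arc_iff[OF assms, of x y] subsetD[OF sub, of "(x, y)"] V
    by (metis mem_Sigma_iff)
  show ?thesis
  proof
    show "finite (pverts ?G)" by (simp add: V)
    show "finite (parcs ?G)" using finite_subset[OF sub] V by simp
    show "fst e \<noteq> snd e" if "e \<in> parcs ?G" for e
      using that assms by (cases e) (auto simp: arc)
    have "gcd (y - x) n = gcd (x - y) n" for x y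
      by (metis gcd_neg1_int minus_diff_eq)
    then show "symmetric (with_proj ?G)"
      by (auto simp: symmetric_def sym_def arc)
  qed (use sub in auto)
qed

end

theory Submission
  imports Defs
begin

text \<open>
  Since \<open>n\<close> is odd, any two vertices have a common neighbour, so the graph has diameter at most two
  and every colour class except the first is a singleton. The packing chromatic number is therefore
  \<open>n - \<alpha> + 1\<close>, where \<open>\<alpha>\<close> is the independence number. Blocks of \<open>p 1\<close> consecutive residues are
  cliques, so \<open>\<alpha> \<le> n / p 1\<close>, and the multiples of \<open>p 1\<close> attain this bound.
\<close>

section \<open>Independent sets, and distances bounded by short walks\<close>

definition independent_set :: "'a pair_pre_digraph \<Rightarrow> 'a set \<Rightarrow> bool" where
  "independent_set G I \<longleftrightarrow> I \<subseteq> pverts G \<and> (\<forall>u\<in>I. \<forall>v\<in>I. u \<noteq> v \<longrightarrow> (u, v) \<notin> parcs G)"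

context pair_wf_digraph
begin

lemma awalk_cost_one: "awalk_cost (\<lambda>_. 1) p = real (length p)"
  by (induction p) auto

lemma graph_dist_le_length:
  assumes "awalk u p v"
  shows "graph_dist G u v \<le> ereal (real (length p))"
  using min_cost_le_walk_cost[OF assms, of "\<lambda>_. 1"] by (simp add: graph_dist_def awalk_cost_one)

lemma graph_dist_le_one:
  assumes "(u, v) \<in> parcs G"
  shows "graph_dist G u v \<le> 1"
proof -
  have "awalk u [(u, v)] v"
    using assms in_arcsD1 in_arcsD2 by (auto simp: awalk_Cons_iff awalk_Nil_iff)
  from graph_dist_le_length[OF this] show ?thesis by (simp add: one_ereal_def)
qed

lemma graph_dist_le_two:
  assumes "(u, w) \<in> parcs G" "(w, v) \<in> parcs G"
  shows "graph_dist G u v \<le> 2"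
proof -
  have "awalk u [(u, w), (w, v)] v"
    using assms in_arcsD1 in_arcsD2 by (auto simp: awalk_Cons_iff awalk_Nil_iff)
  from graph_dist_le_length[OF this] show ?thesis by simp
qed

text \<open>A walk with no arc forces \<open>u = v\<close>, and a walk with one arc is an arc from
  \<open>u\<close> to \<open>v\<close>. If no walk exists, the infimum is infinite, so the bound
  covers that case as well.\<close>

lemma graph_dist_ge_two:
  assumes "u \<noteq> v" "(u, v) \<notin> parcs G"
  shows "2 \<le> graph_dist G u v"
proof -
  have "2 \<le> length p" if p: "awalk u p v" for p
  proof (rule ccontr)
    assume "\<not> 2 \<le> length p"
    then have "p = [] \<or> (\<exists>e. p = [e])"
      by (cases p; cases "tl p") auto
    then show False
      using p assms by (auto simp: awalk_Cons_iff awalk_Nil_iff)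
  qed
  then show ?thesis
    unfolding graph_dist_def \<mu>_def awalk_cost_one by (intro INF_greatest) auto
qed

end

section \<open>Packing colorings of graphs of diameter at most two\<close>

theorem packing_chromatic_number_diameter_two:
  assumes wf: "pair_wf_digraph G"
    and fin: "finite (pverts G)"
    and diam: "\<And>u v. u \<in> pverts G \<Longrightarrow> v \<in> pverts G \<Longrightarrow> graph_dist G u v \<le> 2"
    and I: "independent_set G I" "I \<noteq> {}"
    and max: "\<And>J. independent_set G J \<Longrightarrow> card J \<le> card I"
  shows "packing_chromatic_number G = card (pverts G) - card I + 1"
  unfolding packing_chromatic_number_def
proof (rule Least_equality)
  interpret pair_wf_digraph G by (fact wf)
  have IV: "I \<subseteq> pverts G" using I by (auto simp: independent_set_def)
  let ?R = "pverts G - I"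
  have R: "card ?R = card (pverts G) - card I"
    using IV fin by (intro card_Diff_subset) (auto intro: finite_subset)
  obtain f where f: "bij_betw f {1..card ?R} ?R"
    using ex_bij_betw_nat_finite_1[of ?R] fin by blast
  have fR: "f i \<in> ?R" if "i \<in> {1..card ?R}" for i
    using f that by (auto simp: bij_betw_def)
  \<comment> \<open>Color 1 goes to all of \<open>I\<close>; the shift by one lets the colors from 2
    on enumerate the remaining vertices through \<open>f\<close>, one vertex per color.\<close>
  let ?V = "\<lambda>i::nat. if i = 1 then I else {f (i - 1)}"
  have "packing_coloring G (card ?R + 1) ?V"
    unfolding packing_coloring_def
  proof (intro conjI ballI impI)
    have "{1..card ?R + 1} = insert 1 (Suc ` {1..card ?R})"
      by (auto simp: image_Suc_atLeastAtMost)
    then have "(\<Union>i\<in>{1..card ?R + 1}. ?V i) = ?V 1 \<union> (\<Union>i\<in>{1..card ?R}. ?V (Suc i))"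
      by (simp only: UN_insert image_image)
    also have "\<dots> = I \<union> f ` {1..card ?R}"
      by auto
    finally have "(\<Union>i\<in>{1..card ?R + 1}. ?V i) = I \<union> f ` {1..card ?R}" .
    then show "(\<Union>i\<in>{1..card ?R + 1}. ?V i) = pverts G"
      using f IV by (auto simp: bij_betw_def)
    show "disjoint_family_on ?V {1..card ?R + 1}"
      unfolding disjoint_family_on_def
    proof (intro ballI impI)
      fix i j assume ij: "i \<in> {1..card ?R + 1}" "j \<in> {1..card ?R + 1}" "i \<noteq> j"
      have sub: "k - 1 \<in> {1..card ?R}" if "k \<in> {1..card ?R + 1}" "k \<noteq> 1" for k
        using that by auto
      show "?V i \<inter> ?V j = {}"
      proof (cases "i = 1 \<or> j = 1")
        case True
        then show ?thesis using ij fR[OF sub[of i]] fR[OF sub[of j]] by auto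
      next
        case False
        have "f (i - 1) \<noteq> f (j - 1)"
        proof
          assume "f (i - 1) = f (j - 1)"
          then have "i - 1 = j - 1"
            using f sub[of i] sub[of j] ij False by (auto simp: bij_betw_def dest: inj_onD)
          then show False using ij False by auto
        qed
        then show ?thesis using False by auto
      qed
    qed
    show "?V i \<noteq> {}" for i using I by auto
    show "ereal (real (i + 1)) \<le> graph_dist G u v"
      if "u \<in> ?V i" "v \<in> ?V i" "u \<noteq> v" for i u v
    proof -
      \<comment> \<open>Singleton classes contain no two distinct vertices, so only color 1 has a
        distance condition to check.\<close>
      have "i = 1" "u \<in> I" "v \<in> I" using that by (auto split: if_splits)
      then show ?thesis
        using graph_dist_ge_two[of u v] I that by (auto simp: independent_set_def)
    qed
  qed
  then show "\<exists>V. packing_coloring G (card (pverts G) - card I + 1) V"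
    unfolding R by blast
next
  fix k assume "\<exists>V. packing_coloring G k V"
  interpret pair_wf_digraph G by (fact wf)
  from \<open>\<exists>V. packing_coloring G k V\<close> obtain V where V: "packing_coloring G k V" by blast
  have un: "(\<Union>i\<in>{1..k}. V i) = pverts G" and dis: "disjoint_family_on V {1..k}"
    and dist: "\<And>i u v. i \<in> {1..k} \<Longrightarrow> u \<in> V i \<Longrightarrow> v \<in> V i \<Longrightarrow> u \<noteq> v \<Longrightarrow>
      ereal (real (i + 1)) \<le> graph_dist G u v"
    using V unfolding packing_coloring_def by auto
  \<comment> \<open>\<open>I\<close> supplies a vertex, whereas zero classes cover nothing.\<close>
  have k: "k \<ge> 1"
    using un I by (cases k) (auto simp: independent_set_def)
  have finV: "finite (V i)" if "i \<in> {1..k}" for i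
    using that un fin by (metis UN_upper finite_subset)
  have "independent_set G (V 1)"
    unfolding independent_set_def
  proof (intro conjI ballI impI notI)
    show "V 1 \<subseteq> pverts G" using un k by auto
    fix u v assume "u \<in> V 1" "v \<in> V 1" "u \<noteq> v" "(u, v) \<in> parcs G"
    then have "ereal 2 \<le> 1"
      using dist[of 1 u v] graph_dist_le_one[of u v] k order_trans by fastforce
    then show False by simp
  qed
  then have V1: "card (V 1) \<le> card I" by (rule max)
  \<comment> \<open>From color 2 on, distinct vertices of a class would be at distance at least 3,
    against the diameter.\<close>
  have V2: "card (V i) \<le> 1" if i: "i \<in> {2..k}" for i
  proof -
    have "u = v" if uv: "u \<in> V i" "v \<in> V i" for u v
    proof (rule ccontr)
      assume "u \<noteq> v"
      then have "ereal (real (i + 1)) \<le> graph_dist G u v"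
        using uv i by (intro dist) auto
      also have "\<dots> \<le> 2"
        using un uv i by (intro diam) force+
      finally have "ereal (real (i + 1)) \<le> 2" .
      then show False using i by simp
    qed
    then show ?thesis
      using finV[of i] i by (simp add: card_le_Suc0_iff_eq)
  qed
  \<comment> \<open>Counting vertices class by class gives at most
    \<open>card I + (k - 1)\<close>.\<close>
  have "card (pverts G) = (\<Sum>i\<in>{1..k}. card (V i))"
    using dis finV unfolding un[symmetric]
    by (intro card_UN_disjoint) (auto simp: disjoint_family_on_def)
  also have "\<dots> = card (V 1) + (\<Sum>i\<in>{2..k}. card (V i))"
    using k by (simp add: sum.atLeast_Suc_atMost numeral_2_eq_2)
  also have "\<dots> \<le> card I + (\<Sum>i\<in>{2..k}. 1)"
    using V1 V2 by (intro add_mono sum_mono) auto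
  finally show "card (pverts G) - card I + 1 \<le> k" using k by simp
qed

section \<open>Arithmetic: two units with a prescribed difference\<close>

lemma coprime_if_no_common_prime:
  fixes a b :: "'a :: factorial_semiring_gcd"
  assumes "b \<noteq> 0" "\<And>q. prime q \<Longrightarrow> q dvd b \<Longrightarrow> \<not> q dvd a"
  shows "coprime a b"
proof (rule ccontr)
  assume "\<not> coprime a b"
  then have "gcd a b \<noteq> 0" "\<not> is_unit (gcd a b)"
    using assms(1) by (auto simp: is_unit_gcd)
  then obtain q where "prime q" "q dvd gcd a b" by (rule prime_divisorE)
  then show False using assms(2)[of q] by simp
qed

text \<open>For \<open>d = x - y\<close>, such a \<open>u\<close> makes \<open>x - u\<close> a
  common neighbour of \<open>x\<close> and \<open>y\<close>. Oddness matters: modulo 2,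
  \<open>u\<close> and \<open>u - 1\<close> cannot both be units.\<close>

lemma odd_common_unit_neighbour:
  fixes n d :: int
  assumes "odd n"
  shows "\<exists>u. coprime u n \<and> coprime (u - d) n"
proof -
  define S where "S = {q \<in> prime_factors n. \<not> q dvd d}"
  define m where "m = \<Prod>S"
  have finS: "finite S" by (simp add: S_def)
  have n0: "n \<noteq> 0" using assms by auto
  have dvd_m: "q dvd m \<longleftrightarrow> \<not> q dvd d" if q: "prime q" "q dvd n" for q
  proof
    assume "q dvd m"
    then obtain s where s: "s \<in> S" "q dvd s"
      using q finS by (auto simp: m_def prime_dvd_prod_iff)
    then have "q = s" using q by (auto simp: S_def intro: primes_dvd_imp_eq)
    then show "\<not> q dvd d" using s by (simp add: S_def)
  next
    assume "\<not> q dvd d"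
    then have "q \<in> S" using q n0 by (auto simp: S_def in_prime_factors_iff)
    then show "q dvd m" using finS by (auto simp: m_def)
  qed
  txt \<open>Modulo a prime factor of \<open>n\<close>, exactly one of \<open>d\<close> and \<open>m\<close> vanishes, so \<open>u = 2 * d + m\<close> works
    at every such prime without the Chinese remainder theorem.\<close>
  have "coprime (2 * d + m) n"
  proof (rule coprime_if_no_common_prime[OF n0])
    fix q assume q: "prime q" "q dvd n"
    \<comment> \<open>As \<open>n\<close> is odd, 2 is invertible modulo \<open>q\<close>, so
      \<open>2 * d\<close> vanishes there exactly when \<open>d\<close> does.\<close>
    then have "\<not> q dvd 2"
      using assms primes_dvd_imp_eq[of q 2] by auto
    then have "q dvd 2 * d \<longleftrightarrow> q dvd d"
      using q by (simp add: prime_dvd_mult_iff)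
    then show "\<not> q dvd 2 * d + m"
      using dvd_m[OF q] by (cases "q dvd d") (simp_all add: dvd_add_right_iff dvd_add_left_iff)
  qed
  moreover have "coprime (d + m) n"
  proof (rule coprime_if_no_common_prime[OF n0])
    fix q assume q: "prime q" "q dvd n"
    show "\<not> q dvd d + m"
      using dvd_m[OF q] by (cases "q dvd d") (simp_all add: dvd_add_right_iff dvd_add_left_iff)
  qed
  moreover have "2 * d + m - d = d + m" by simp
  ultimately show ?thesis by metis
qed

section \<open>Diameter and independence number of the unitary Cayley graph\<close>

lemma pverts_unitary_cayley_graph_residue_ring:
  "pverts (unitary_cayley_graph (residue_ring n)) = {0..<n}"
  by (auto simp: unitary_cayley_graph_def residue_ring_def)

lemma graph_dist_unitary_cayley_graph_le_two:
  fixes n x y :: int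
  assumes n: "1 < n" "odd n" and xy: "x \<in> {0..<n}" "y \<in> {0..<n}"
  shows "graph_dist (unitary_cayley_graph (residue_ring n)) x y \<le> 2"
proof -
  interpret pair_graph "unitary_cayley_graph (residue_ring n)"
    using n(1) by (rule pair_graph_unitary_cayley_graph)
  obtain u where u: "coprime u n" "coprime (u - (x - y)) n"
    using odd_common_unit_neighbour[OF n(2)] by blast
  \<comment> \<open>Chosen so that \<open>x - w\<close> is congruent to \<open>u\<close> and
    \<open>w - y\<close> to the negative of \<open>u - (x - y)\<close>, both units.\<close>
  define w where "w = (x - u) mod n"
  have w: "w \<in> {0..<n}" using n by (simp add: w_def)
  have cong_coprime: "coprime a n \<longleftrightarrow> coprime b n" if "[a = b] (mod n)" for a b
    using that by (metis cong_imp_coprime cong_sym)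
  have "[x - w = u] (mod n)" "[w - y = - (u - (x - y))] (mod n)"
    by (simp_all add: w_def cong_def mod_simps algebra_simps)
  then have "coprime (x - w) n" "coprime (w - y) n"
    using u cong_coprime by (metis, metis coprime_minus_left_iff)
  then show ?thesis
    using n xy w
    by (intro graph_dist_le_two[of x w y])
      (simp_all add: unitary_cayley_graph_residue_ring_arc_iff coprime_iff_gcd_eq_1)
qed

text \<open>Distinct vertices with the same quotient by \<open>q\<close> differ by less than
  \<open>q\<close>, hence by less than every prime divisor of \<open>n\<close>. Their difference is
  thus a unit, so \<open>J\<close> meets each of the \<open>n div q\<close> blocks at most
  once.\<close>

lemma card_independent_set_unitary_cayley_graph_le:
  fixes n q :: int
  assumes n: "1 < n" and q: "q dvd n" "0 < q"
    and least: "\<And>s. prime s \<Longrightarrow> s dvd n \<Longrightarrow> q \<le> s"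
    and J: "independent_set (unitary_cayley_graph (residue_ring n)) J"
  shows "card J \<le> nat (n div q)"
proof -
  let ?G = "unitary_cayley_graph (residue_ring n)"
  have JV: "J \<subseteq> {0..<n}"
    using J by (simp add: independent_set_def pverts_unitary_cayley_graph_residue_ring)
  have "inj_on (\<lambda>x. x div q) J"
  proof (rule inj_onI, rule ccontr)
    fix x y assume x: "x \<in> J" and y: "y \<in> J" and eq: "x div q = y div q" and "x \<noteq> y"
    have "x - y = x mod q - y mod q"
      using eq by (metis add_diff_cancel_left mult_div_mod_eq)
    then have less: "\<bar>x - y\<bar> < q"
      using q(2) pos_mod_bound[of q x] pos_mod_bound[of q y] pos_mod_sign[of q x] pos_mod_sign[of q y]
      by linarith
    have "coprime (x - y) n"
    proof (rule coprime_if_no_common_prime, use n in simp, rule notI)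
      fix s assume s: "prime s" "s dvd n" "s dvd x - y"
      then have "s \<le> \<bar>x - y\<bar>"
        using \<open>x \<noteq> y\<close> by (intro zdvd_imp_le) auto
      then show False using least[of s] s less by simp
    qed
    then have "(x, y) \<in> parcs ?G"
      using n x y JV by (subst unitary_cayley_graph_residue_ring_arc_iff) (auto simp: coprime_iff_gcd_eq_1)
    then show False using J x y \<open>x \<noteq> y\<close> by (auto simp: independent_set_def)
  qed
  moreover have "(\<lambda>x. x div q) ` J \<subseteq> {0..<n div q}"
  proof -
    \<comment> \<open>The inequality is strict because \<open>q\<close> divides \<open>n\<close>, so
      no incomplete block is left at the end.\<close>
    have "x div q < n div q" if "x < n" for x
    proof -
      have "q * (x div q) \<le> x"
        using q(2) mult_div_mod_eq[of q x] pos_mod_sign[of q x] by linarith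
      also have "x < q * (n div q)" using that q(1) by simp
      finally show ?thesis using q(2) by simp
    qed
    then show ?thesis using JV q by (auto simp: pos_imp_zdiv_nonneg_iff)
  qed
  ultimately have "card J \<le> card {0..<n div q}"
    by (intro card_inj_on_le) auto
  then show ?thesis by simp
qed

theorem packing_chromatic_number_unitary_cayley_graph:
  fixes n q :: int
  assumes n: "1 < n" "odd n" and q: "prime q" "q dvd n"
    and least: "\<And>s. prime s \<Longrightarrow> s dvd n \<Longrightarrow> q \<le> s"
  shows "packing_chromatic_number (unitary_cayley_graph (residue_ring n)) =
    nat n - nat (n div q) + 1"
proof -
  let ?G = "unitary_cayley_graph (residue_ring n)"
  interpret pair_graph ?G using n(1) by (rule pair_graph_unitary_cayley_graph)
  have V: "pverts ?G = {0..<n}"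
    by (rule pverts_unitary_cayley_graph_residue_ring)
  have q0: "0 < q" using q(1) by (rule prime_gt_0_int)
  obtain m where m: "n = q * m" using q(2) by blast
  have m0: "0 < m" using n m q0 by (metis less_trans zero_less_mult_pos zero_less_one)
  \<comment> \<open>The multiples of \<open>q\<close> below \<open>n\<close>: their differences
    share the factor \<open>q\<close> with \<open>n\<close>, so none of them is a unit.\<close>
  let ?I = "(\<lambda>x. q * x) ` {0..<m}"
  have IV: "?I \<subseteq> {0..<n}" using m q0 by auto
  have cI: "card ?I = nat (n div q)"
    using m q0 by (subst card_image) (auto simp: inj_on_def)
  have "independent_set ?G ?I"
    unfolding independent_set_def
  proof (intro conjI ballI impI notI)
    show "?I \<subseteq> pverts ?G" using IV V by simp
    fix u v assume uv: "u \<in> ?I" "v \<in> ?I" "(u, v) \<in> parcs ?G"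
    then have "gcd (u - v) n = 1"
      using unitary_cayley_graph_residue_ring_arc_iff[of n u v] n IV by blast
    moreover have "q dvd gcd (u - v) n" using uv m by auto
    ultimately show False using q(1) by (simp add: not_prime_unit)
  qed
  then have "packing_chromatic_number ?G = card (pverts ?G) - card ?I + 1"
    using m0 n V card_independent_set_unitary_cayley_graph_le[OF n(1) q(2) q0 least]
    by (intro packing_chromatic_number_diameter_two graph_dist_unitary_cayley_graph_le_two)
      (auto simp: cI simp del: card_image intro: pair_wf_digraph_axioms)
  then show ?thesis using V cI by simp
qed

section \<open>The formula in terms of the prime factorization\<close>

theorem theorem2p6:
  fixes n t :: nat and p r :: "nat \<Rightarrow> nat"
  assumes "n = (\<Prod>i=1..t. p i ^ r i)"
    and "t > 1"
    and "\<And>i. i \<in> {1..t} \<Longrightarrow> r i \<ge> 1"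
    and "\<And>i. i \<in> {1..t} \<Longrightarrow> prime (p i)"
    and "3 \<le> p 1"
    and "strict_mono_on {1..t} p"
  shows "packing_chromatic_number (unitary_cayley_graph (residue_ring (int n))) =
           p 1 ^ (r 1 - 1) * (\<Prod>i=2..t. p i ^ r i) * (p 1 - 1) + 1"
proof -
  \<comment> \<open>This is \<open>n\<close> divided by \<open>p 1\<close>, so the value
    \<open>n - m + 1\<close> becomes \<open>m * (p 1 - 1) + 1\<close>.\<close>
  define m where "m = p 1 ^ (r 1 - 1) * (\<Prod>i=2..t. p i ^ r i)"
  have "n = p 1 ^ r 1 * (\<Prod>i=2..t. p i ^ r i)"
    using assms(1,2) by (simp add: prod.atLeast_Suc_atMost numeral_2_eq_2)
  moreover have "p 1 ^ r 1 = p 1 * p 1 ^ (r 1 - 1)"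
    using assms(2) assms(3)[of 1] by (simp flip: power_Suc)
  ultimately have nm: "n = p 1 * m" by (simp add: m_def mult.assoc)
  have n0: "n > 0" using assms(1,4) by (auto intro!: prod_pos simp: prime_gt_0_nat)
  then have "m > 0" using nm by simp
  then have n3: "3 \<le> n" using nm assms(5) by (metis le_trans mult.commute mult_le_mono1 nat_mult_1 Suc_leI One_nat_def)
  have least: "p 1 \<le> s" if s: "prime s" "s dvd n" for s
  proof -
    obtain i where i: "i \<in> {1..t}" "s dvd p i ^ r i"
      using s assms(1) by (auto simp: prime_dvd_prod_iff)
    then have "s = p i"
      using s(1) assms(4)[of i] prime_dvd_power primes_dvd_imp_eq by blast
    moreover have "p 1 \<le> p i"
      using assms(6) i by (cases "i = 1") (auto simp: strict_mono_on_def less_imp_le)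
    ultimately show ?thesis by simp
  qed
  \<comment> \<open>If 2 divided \<open>n\<close>, minimality would give
    \<open>p 1 \<le> 2\<close>.\<close>
  have "odd n" using least[of 2] assms(5) two_is_prime_nat by auto
  have "packing_chromatic_number (unitary_cayley_graph (residue_ring (int n))) =
      nat (int n) - nat (int n div int (p 1)) + 1"
  proof (rule packing_chromatic_number_unitary_cayley_graph)
    show "1 < int n" using n3 by simp
    show "odd (int n)" using \<open>odd n\<close> by simp
    show "prime (int (p 1))" using assms(2) assms(4)[of 1] by simp
    show "int (p 1) dvd int n" using nm by simp
    show "int (p 1) \<le> s" if "prime s" "s dvd int n" for s
      using least[of "nat s"] that by (simp add: prime_ge_0_int nat_dvd_iff prime_nat_iff_prime le_nat_iff)
  qed
  also have "int n div int (p 1) = int m"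
    using nm assms(5) by simp
  also have "nat (int n) - nat (int m) + 1 = m * (p 1 - 1) + 1"
    unfolding nm nat_int by (simp add: diff_mult_distrib2 mult.commute)
  finally show ?thesis by (simp add: m_def)
qed

end
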